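(* The following curves $\gamma:I\to S^n\subset\mathbb R^{n+1}$ ($I\subset\mathbb R$ an interval) are $3$-harmonic and $4$-harmonic: (1) $\gamma(t)=\cos(\sqrt2\,t)c_1+\sin(\sqrt2\,t)c_2+c_4$, where $c_1,c_2,c_4\in\mathbb R^{n+1}$ are constant vectors orthogonal to each other with $|c_1|^2=|c_2|^2=|c_4|^2=\frac12$; (2) $\gamma(t)=\cos(at)c_1+\sin(at)c_2+\cos(bt)c_3+\sin(bt)c_4$, where $c_1,c_2,c_3,c_4\in\mathbb R^{n+1}$ are constant vectors orthogonal to each other with $|c_1|^2=|c_2|^2=|c_3|^2=|c_4|^2=\frac12$, and $a,b\in\mathbb R$ satisfy $a^2+b^2=2$, $a^2\ne b^2$.
   Context: $S^n$ is the unit sphere with its standard metric of constant sectional curvature $1$, Levi-Civita connection $\nabla$ and curvature tensor $R(X,Y)=\nabla_X\nabla_Y-\nabla_Y\nabla_X-\nabla_{[X,Y]}$. For a unit-speed curve $\gamma$ in $S^n$ put $\tau(\gamma)=\nabla_{\gamma'}\gamma'$ and, for vector fields $V$ along $\gamma$, $\overline\Delta V=-\nabla_{\gamma'}\nabla_{\gamma'}V$. For $k\ge2$, $\gamma$ is $k$-harmonic if $\tau_k(\gamma):=\overline\Delta^{k-1}\tau(\gamma)-R\big(\overline\Delta^{k-2}\tau(\gamma),\gamma'\big)\gamma'=0$. *)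

theory Defs
  imports "HOL-Analysis.Analysis"
begin

text \<open>
  The unit sphere \<^term>\<open>sphere 0 1\<close> of a Euclidean space carries the metric induced by the
  ambient inner product; its tangent space at \<open>x\<close> is the orthogonal complement of \<open>x\<close>.
\<close>

definition tan_proj :: "'a::euclidean_space \<Rightarrow> 'a \<Rightarrow> 'a" where
  "tan_proj x w = w - (w \<bullet> x) *\<^sub>R x"

primrec Ck_on :: "nat \<Rightarrow> 'a::euclidean_space set \<Rightarrow> ('a \<Rightarrow> 'b::euclidean_space) \<Rightarrow> bool" where
  "Ck_on 0 U f \<longleftrightarrow> continuous_on U f"
| "Ck_on (Suc k) U f \<longleftrightarrow>
     f differentiable_on U \<and> (\<forall>v. Ck_on k U (\<lambda>x. frechet_derivative f (at x) v))"

text \<open>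
  A smooth vector field on the sphere is represented by a map that is smooth on an open
  neighbourhood of the sphere and tangent to the sphere at the points of the sphere.
\<close>

definition sphere_field :: "('a::euclidean_space \<Rightarrow> 'a) \<Rightarrow> bool" where
  "sphere_field X \<longleftrightarrow>
     (\<exists>U. open U \<and> sphere 0 1 \<subseteq> U \<and> (\<forall>k. Ck_on k U X)) \<and> (\<forall>x\<in>sphere 0 1. X x \<bullet> x = 0)"

text \<open>
  The Levi-Civita connection of the induced metric is the tangential part of the ambient
  derivative; that it is torsion-free and metric is checked in \<open>sphere_conn_torsion_free\<close>
  and \<open>sphere_conn_metric\<close> below.
\<close>

definition sphere_conn :: "('a::euclidean_space \<Rightarrow> 'a) \<Rightarrow> ('a \<Rightarrow> 'a) \<Rightarrow> 'a \<Rightarrow> 'a" where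
  "sphere_conn X Y = (\<lambda>x. tan_proj x (frechet_derivative Y (at x) (X x)))"

definition lie_bracket :: "('a::euclidean_space \<Rightarrow> 'a) \<Rightarrow> ('a \<Rightarrow> 'a) \<Rightarrow> 'a \<Rightarrow> 'a" where
  "lie_bracket X Y =
     (\<lambda>x. frechet_derivative Y (at x) (X x) - frechet_derivative X (at x) (Y x))"

definition field_curvature ::
  "('a::euclidean_space \<Rightarrow> 'a) \<Rightarrow> ('a \<Rightarrow> 'a) \<Rightarrow> ('a \<Rightarrow> 'a) \<Rightarrow> 'a \<Rightarrow> 'a" where
  "field_curvature X Y Z = (\<lambda>x. sphere_conn X (sphere_conn Y Z) x
     - sphere_conn Y (sphere_conn X Z) x - sphere_conn (lie_bracket X Y) Z x)"

text \<open>
  The curvature tensor \<open>R(u,v)w\<close> at \<open>x\<close>, for tangent vectors \<open>u, v, w\<close>: the common value of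
  \<open>R(X,Y)Z\<close> at \<open>x\<close> over all vector fields extending them (well defined by
  \<open>sphere_curvature_eq\<close> below).
\<close>

definition sphere_curvature :: "'a::euclidean_space \<Rightarrow> 'a \<Rightarrow> 'a \<Rightarrow> 'a \<Rightarrow> 'a" where
  "sphere_curvature x u v w = (THE r. \<forall>X Y Z.
     sphere_field X \<and> sphere_field Y \<and> sphere_field Z \<and> X x = u \<and> Y x = v \<and> Z x = w \<longrightarrow>
     field_curvature X Y Z x = r)"

text \<open>
  Curves are functions on \<^typ>\<open>real\<close> restricted to an interval \<open>I\<close>; derivatives are taken within
  \<open>I\<close>, hence one-sided at endpoints belonging to \<open>I\<close>.
\<close>

definition vderiv :: "real set \<Rightarrow> (real \<Rightarrow> 'a::euclidean_space) \<Rightarrow> real \<Rightarrow> 'a" where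
  "vderiv I f = (\<lambda>t. vector_derivative f (at t within I))"

definition unit_speed_sphere_curve :: "real set \<Rightarrow> (real \<Rightarrow> 'a::euclidean_space) \<Rightarrow> bool" where
  "unit_speed_sphere_curve I \<gamma> \<longleftrightarrow>
     (\<forall>t\<in>I. \<gamma> t \<in> sphere 0 1) \<and>
     (\<forall>k. \<forall>t\<in>I. (vderiv I ^^ k) \<gamma> differentiable (at t within I)) \<and>
     (\<forall>t\<in>I. norm (vderiv I \<gamma> t) = 1)"

text \<open>
  The covariant derivative along a curve induced by the Levi-Civita connection; see
  \<open>cov_deriv_along\<close> below.
\<close>

definition cov_deriv ::
  "real set \<Rightarrow> (real \<Rightarrow> 'a::euclidean_space) \<Rightarrow> (real \<Rightarrow> 'a) \<Rightarrow> real \<Rightarrow> 'a" where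
  "cov_deriv I \<gamma> V = (\<lambda>t. tan_proj (\<gamma> t) (vderiv I V t))"

definition tension :: "real set \<Rightarrow> (real \<Rightarrow> 'a::euclidean_space) \<Rightarrow> real \<Rightarrow> 'a" where
  "tension I \<gamma> = cov_deriv I \<gamma> (vderiv I \<gamma>)"

definition rough_laplacian ::
  "real set \<Rightarrow> (real \<Rightarrow> 'a::euclidean_space) \<Rightarrow> (real \<Rightarrow> 'a) \<Rightarrow> real \<Rightarrow> 'a" where
  "rough_laplacian I \<gamma> V = (\<lambda>t. - cov_deriv I \<gamma> (cov_deriv I \<gamma> V) t)"

definition k_tension :: "nat \<Rightarrow> real set \<Rightarrow> (real \<Rightarrow> 'a::euclidean_space) \<Rightarrow> real \<Rightarrow> 'a" where
  "k_tension k I \<gamma> = (\<lambda>t. (rough_laplacian I \<gamma> ^^ (k - 1)) (tension I \<gamma>) t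
     - sphere_curvature (\<gamma> t) ((rough_laplacian I \<gamma> ^^ (k - 2)) (tension I \<gamma>) t)
         (vderiv I \<gamma> t) (vderiv I \<gamma> t))"

definition k_harmonic :: "nat \<Rightarrow> real set \<Rightarrow> (real \<Rightarrow> 'a::euclidean_space) \<Rightarrow> bool" where
  "k_harmonic k I \<gamma> \<longleftrightarrow>
     2 \<le> k \<and> unit_speed_sphere_curve I \<gamma> \<and> (\<forall>t\<in>I. k_tension k I \<gamma> t = 0)"


subsection \<open>The definitions agree with the Riemannian ones\<close>

lemma Ck_on_const: "Ck_on k U (\<lambda>x. c)"
proof (induction k arbitrary: c)
  case (Suc k)
  then show ?case by (auto simp: differentiable_on_def)
qed (simp add: continuous_on_const)

lemma Ck_on_linear:
  fixes f :: "'a::euclidean_space \<Rightarrow> 'b::euclidean_space"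
  assumes "bounded_linear f"
  shows "Ck_on k U (\<lambda>x. f x + c)"
proof (cases k)
  case 0
  then show ?thesis
    using assms by (simp add: continuous_on_add linear_continuous_on)
next
  case (Suc j)
  have d: "((\<lambda>x. f x + c) has_derivative f) (at x)" for x
    using bounded_linear_imp_has_derivative[OF assms] by (auto intro!: derivative_eq_intros)
  have "frechet_derivative (\<lambda>x. f x + c) (at x) = f" for x
    using frechet_derivative_at[OF d] by simp
  moreover have "(\<lambda>x. f x + c) differentiable_on U"
    using d by (auto simp: differentiable_on_def intro: differentiable_at_withinI differentiableI)
  ultimately show ?thesis
    using Suc by (simp add: Ck_on_const)
qed

lemma sphere_field_extension:
  fixes x u :: "'a::euclidean_space"
  assumes "x \<in> sphere 0 1" "u \<bullet> x = 0"
  obtains X where "sphere_field X" "X x = u"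
proof
  let ?X = "\<lambda>y. u - (u \<bullet> y) *\<^sub>R y"
  have d: "(?X has_derivative (\<lambda>h. - ((u \<bullet> y) *\<^sub>R h + (u \<bullet> h) *\<^sub>R y))) (at y)" for y
    by (auto intro!: derivative_eq_intros)
  have fd: "frechet_derivative ?X (at y) = (\<lambda>h. - ((u \<bullet> y) *\<^sub>R h + (u \<bullet> h) *\<^sub>R y))" for y
    using frechet_derivative_at[OF d] by simp
  have lin: "bounded_linear (\<lambda>y. - ((u \<bullet> y) *\<^sub>R v + (u \<bullet> v) *\<^sub>R y))" for v
    by (intro bounded_linear_minus bounded_linear_add bounded_linear_scaleR_const
          bounded_linear_inner_right bounded_linear_const_scaleR bounded_linear_ident)
  have "Ck_on k UNIV ?X" for k
  proof (cases k)
    case 0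
    then show ?thesis by (auto intro!: continuous_intros)
  next
    case (Suc j)
    have "?X differentiable_on UNIV"
      using d by (auto simp: differentiable_on_def intro: differentiable_at_withinI differentiableI)
    then show ?thesis
      using Suc Ck_on_linear[OF lin, where c = 0] by (simp add: fd)
  qed
  then show "sphere_field ?X"
    by (auto simp: sphere_field_def inner_diff_left dot_square_norm intro!: exI[of _ UNIV])
  show "?X x = u"
    using assms by simp
qed

lemma Ck_on_has_derivative:
  assumes "Ck_on (Suc k) U f" "open U" "x \<in> U"
  shows "(f has_derivative frechet_derivative f (at x)) (at x)"
  using assms
  by (metis Ck_on.simps(2) at_within_open differentiable_on_def frechet_derivative_works)

lemma Ck_on_deriv: "Ck_on (Suc k) U f \<Longrightarrow> Ck_on k U (\<lambda>x. frechet_derivative f (at x) v)"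
  by simp

lemma second_difference:
  fixes f :: "'a::euclidean_space \<Rightarrow> real"
  assumes U: "open U" and f: "Ck_on 2 U f" and b: "ball x r \<subseteq> U"
    and h: "0 < h" "h * (norm u + norm v) < r"
  shows "\<exists>p. dist x p \<le> h * (norm u + norm v) \<and>
    f (x + h *\<^sub>R u + h *\<^sub>R v) - f (x + h *\<^sub>R u) - f (x + h *\<^sub>R v) + f x
      = h\<^sup>2 * frechet_derivative (\<lambda>y. frechet_derivative f (at y) u) (at p) v"
proof -
  let ?\<phi> = "\<lambda>y. frechet_derivative f (at y) u"
  have f2: "Ck_on (Suc (Suc 0)) U f" using f by (simp add: numeral_2_eq_2)
  have nrm: "norm (s *\<^sub>R u + t *\<^sub>R v) \<le> h * (norm u + norm v)"
    if "0 \<le> s" "s \<le> h" "0 \<le> t" "t \<le> h" for s t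
  proof -
    have "norm (s *\<^sub>R u + t *\<^sub>R v) \<le> s * norm u + t * norm v"
      using that by (metis abs_of_nonneg norm_scaleR norm_triangle_ineq)
    also have "\<dots> \<le> h * norm u + h * norm v"
      using that by (intro add_mono mult_right_mono) auto
    finally show ?thesis by (simp add: distrib_left)
  qed
  have inU: "x + s *\<^sub>R u + t *\<^sub>R v \<in> U"
    if "0 \<le> s" "s \<le> h" "0 \<le> t" "t \<le> h" for s t
  proof -
    have "dist x (x + s *\<^sub>R u + t *\<^sub>R v) = norm (s *\<^sub>R u + t *\<^sub>R v)"
      by (metis add.assoc add_diff_cancel_left' dist_commute dist_norm)
    then show ?thesis using nrm[OF that] h b by (auto simp: subset_iff)
  qed
  have Df: "(f has_derivative frechet_derivative f (at y)) (at y)" if "y \<in> U" for y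
    using Ck_on_has_derivative[OF f2 U that] .
  have D\<phi>: "(?\<phi> has_derivative frechet_derivative ?\<phi> (at y)) (at y)" if "y \<in> U" for y
    using Ck_on_has_derivative[OF Ck_on_deriv[OF f2] U that] .
  define g where "g s = f (x + s *\<^sub>R u + h *\<^sub>R v) - f (x + s *\<^sub>R u + 0 *\<^sub>R v)" for s
  have line: "((\<lambda>s. f (x + s *\<^sub>R u + t *\<^sub>R v)) has_derivative
      (\<lambda>d. d * ?\<phi> (x + s *\<^sub>R u + t *\<^sub>R v))) (at s)"
    if "0 \<le> s" "s \<le> h" "0 \<le> t" "t \<le> h" for s t
  proof -
    have l: "((\<lambda>s. x + s *\<^sub>R u + t *\<^sub>R v) has_derivative (\<lambda>d. d *\<^sub>R u)) (at s)"
      by (auto intro!: derivative_eq_intros)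
    have lin: "linear (frechet_derivative f (at (x + s *\<^sub>R u + t *\<^sub>R v)))"
      using Df[OF inU[OF that]] has_derivative_linear by blast
    show ?thesis
      using has_derivative_compose[OF l Df[OF inU[OF that]]] by (simp add: linear_cmul[OF lin])
  qed
  have "\<exists>\<xi>\<in>{0<..<h}. g h - g 0 = (\<lambda>d. d * (?\<phi> (x + \<xi> *\<^sub>R u + h *\<^sub>R v) - ?\<phi> (x + \<xi> *\<^sub>R u + 0 *\<^sub>R v))) (h - 0)"
  proof (rule mvt_simple[OF h(1)])
    fix s assume s: "0 \<le> s" "s \<le> h"
    show "(g has_derivative (\<lambda>d. d * (?\<phi> (x + s *\<^sub>R u + h *\<^sub>R v) - ?\<phi> (x + s *\<^sub>R u + 0 *\<^sub>R v)))) (at s within {0..h})"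
      unfolding g_def right_diff_distrib
      by (rule has_derivative_at_withinI, rule has_derivative_diff; rule line) (use s h(1) in simp_all)
  qed
  then obtain \<xi> where \<xi>: "0 < \<xi>" "\<xi> < h"
    and g: "g h - g 0 = h * (?\<phi> (x + \<xi> *\<^sub>R u + h *\<^sub>R v) - ?\<phi> (x + \<xi> *\<^sub>R u + 0 *\<^sub>R v))"
    by auto
  have "\<exists>\<eta>\<in>{0<..<h}. ?\<phi> (x + \<xi> *\<^sub>R u + h *\<^sub>R v) - ?\<phi> (x + \<xi> *\<^sub>R u + 0 *\<^sub>R v)
      = (\<lambda>d. d * frechet_derivative ?\<phi> (at (x + \<xi> *\<^sub>R u + \<eta> *\<^sub>R v)) v) (h - 0)"
  proof (rule mvt_simple[OF h(1)])
    fix t assume t: "0 \<le> t" "t \<le> h"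
    have U': "x + \<xi> *\<^sub>R u + t *\<^sub>R v \<in> U" using inU t \<xi> by simp
    have l: "((\<lambda>t. x + \<xi> *\<^sub>R u + t *\<^sub>R v) has_derivative (\<lambda>d. d *\<^sub>R v)) (at t)"
      by (auto intro!: derivative_eq_intros)
    have lin: "linear (frechet_derivative ?\<phi> (at (x + \<xi> *\<^sub>R u + t *\<^sub>R v)))"
      using D\<phi>[OF U'] has_derivative_linear by blast
    show "((\<lambda>t. ?\<phi> (x + \<xi> *\<^sub>R u + t *\<^sub>R v)) has_derivative
        (\<lambda>d. d * frechet_derivative ?\<phi> (at (x + \<xi> *\<^sub>R u + t *\<^sub>R v)) v)) (at t within {0..h})"
      using has_derivative_compose[OF l D\<phi>[OF U']]
      by - (rule has_derivative_at_withinI, simp add: linear_cmul[OF lin])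
  qed
  then obtain \<eta> where \<eta>: "0 < \<eta>" "\<eta> < h"
    and g2: "?\<phi> (x + \<xi> *\<^sub>R u + h *\<^sub>R v) - ?\<phi> (x + \<xi> *\<^sub>R u + 0 *\<^sub>R v)
      = h * frechet_derivative ?\<phi> (at (x + \<xi> *\<^sub>R u + \<eta> *\<^sub>R v)) v"
    by auto
  have "dist x (x + \<xi> *\<^sub>R u + \<eta> *\<^sub>R v) = norm (\<xi> *\<^sub>R u + \<eta> *\<^sub>R v)"
    by (metis add.assoc add_diff_cancel_left' dist_commute dist_norm)
  moreover have "f (x + h *\<^sub>R u + h *\<^sub>R v) - f (x + h *\<^sub>R u) - f (x + h *\<^sub>R v) + f x = g h - g 0"
    by (simp add: g_def)
  ultimately show ?thesis
    using g g2 nrm[of \<xi> \<eta>] \<xi> \<eta>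
    by (intro exI[of _ "x + \<xi> *\<^sub>R u + \<eta> *\<^sub>R v"]) (simp add: power2_eq_square)
qed

lemma second_derivative_symmetric_real:
  fixes f :: "'a::euclidean_space \<Rightarrow> real"
  assumes U: "open U" and f: "Ck_on 2 U f" and x: "x \<in> U"
  shows "frechet_derivative (\<lambda>y. frechet_derivative f (at y) u) (at x) v
       = frechet_derivative (\<lambda>y. frechet_derivative f (at y) v) (at x) u"
proof -
  let ?D = "\<lambda>u v p. frechet_derivative (\<lambda>y. frechet_derivative f (at y) u) (at p) v"
  obtain r where r: "0 < r" "ball x r \<subseteq> U"
    using U x open_contains_ball by blast
  define K where "K = norm u + norm v + 1"
  have K: "K > 0" by (simp add: K_def add_nonneg_pos)
  define h where "h n = r / (K * real (Suc n))" for n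
  have h: "0 < h n" "h n * (norm u + norm v) < r" for n
  proof -
    show "0 < h n" using r K by (simp add: h_def del: of_nat_Suc)
    then have "h n * (norm u + norm v) < h n * K" by (simp add: K_def)
    also have "h n * K = r / real (Suc n)" using K by (simp add: h_def)
    also have "\<dots> \<le> r" using r by (simp add: field_simps)
    finally show "h n * (norm u + norm v) < r" .
  qed
  have "\<exists>p q. dist x p \<le> h n * K \<and> dist x q \<le> h n * K \<and> ?D u v p = ?D v u q" for n
  proof -
    obtain p where p: "dist x p \<le> h n * (norm u + norm v)"
      "f (x + h n *\<^sub>R u + h n *\<^sub>R v) - f (x + h n *\<^sub>R u) - f (x + h n *\<^sub>R v) + f x = (h n)\<^sup>2 * ?D u v p"
      using second_difference[OF U f r(2) h] by blast
    have h': "h n * (norm v + norm u) < r" using h by (simp add: add.commute)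
    obtain q where q: "dist x q \<le> h n * (norm v + norm u)"
      "f (x + h n *\<^sub>R v + h n *\<^sub>R u) - f (x + h n *\<^sub>R v) - f (x + h n *\<^sub>R u) + f x = (h n)\<^sup>2 * ?D v u q"
      using second_difference[OF U f r(2) h(1) h'] by blast
    have "(h n)\<^sup>2 * ?D u v p = (h n)\<^sup>2 * ?D v u q"
      using p(2) q(2) by (simp add: algebra_simps)
    then have "?D u v p = ?D v u q" using h(1)[of n] by simp
    moreover have "h n * (norm u + norm v) \<le> h n * K" "h n * (norm v + norm u) \<le> h n * K"
      using h(1)[of n] by (auto simp: K_def)
    ultimately show ?thesis using p(1) q(1) by (meson order_trans)
  qed
  then obtain p q where p: "\<And>n. dist x (p n) \<le> h n * K" and q: "\<And>n. dist x (q n) \<le> h n * K"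
    and eq: "\<And>n. ?D u v (p n) = ?D v u (q n)" by metis
  have "(\<lambda>n. r / real (Suc n)) \<longlonglongrightarrow> 0"
    by (rule LIMSEQ_Suc[OF lim_const_over_n])
  moreover have "h n * K = r / real (Suc n)" for n using K by (simp add: h_def)
  ultimately have hK: "(\<lambda>n. h n * K) \<longlonglongrightarrow> 0" by simp
  have lim: "s \<longlonglongrightarrow> x" if s: "\<And>n. dist x (s n) \<le> h n * K" for s :: "nat \<Rightarrow> 'a"
  proof -
    have "(\<lambda>n. dist (s n) x) \<longlonglongrightarrow> 0"
    proof (rule tendsto_sandwich[OF _ _ tendsto_const hK])
      show "\<forall>\<^sub>F n in sequentially. 0 \<le> dist (s n) x" by simp
      show "\<forall>\<^sub>F n in sequentially. dist (s n) x \<le> h n * K" using s by (simp add: dist_commute)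
    qed
    then show ?thesis using tendsto_dist_iff by blast
  qed
  have cont: "isCont (?D a b) x" for a b
  proof -
    have "Ck_on 0 U (?D a b)" using f by (simp add: numeral_2_eq_2)
    then show ?thesis using U x continuous_on_eq_continuous_at by auto
  qed
  have "(\<lambda>n. ?D u v (p n)) \<longlonglongrightarrow> ?D u v x" "(\<lambda>n. ?D v u (q n)) \<longlonglongrightarrow> ?D v u x"
    using isCont_tendsto_compose[OF cont lim] p q by blast+
  then show ?thesis
    using eq LIMSEQ_unique by simp
qed

lemma Ck_on_cong:
  assumes "open U" "\<And>x. x \<in> U \<Longrightarrow> f x = g x" "Ck_on k U f"
  shows "Ck_on k U g"
  using assms(2,3)
proof (induction k arbitrary: f g)
  case 0
  then show ?case using continuous_on_cong by force
next
  case (Suc k)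
  have d: "(g has_derivative frechet_derivative f (at x)) (at x)" if "x \<in> U" for x
    using has_derivative_transform_within_open[OF Ck_on_has_derivative[OF Suc.prems(2) assms(1) that]
        assms(1) that] Suc.prems(1) by blast
  then have "frechet_derivative f (at x) = frechet_derivative g (at x)" if "x \<in> U" for x
    using frechet_derivative_at that by blast
  moreover have "g differentiable_on U"
    using d by (auto simp: differentiable_on_def intro: differentiable_at_withinI differentiableI)
  ultimately show ?case
    using Suc.IH Suc.prems(2) by (metis (no_types, lifting) Ck_on.simps(2))
qed

lemma Ck_on_inner:
  assumes "open U" "Ck_on k U f"
  shows "Ck_on k U (\<lambda>x. f x \<bullet> e)"
  using assms(2)
proof (induction k arbitrary: f)
  case 0
  then show ?case by (auto intro!: continuous_intros)
next
  case (Suc k)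
  have d: "((\<lambda>x. f x \<bullet> e) has_derivative (\<lambda>v. frechet_derivative f (at x) v \<bullet> e)) (at x)"
    if "x \<in> U" for x
    using Ck_on_has_derivative[OF Suc.prems assms(1) that] by (rule has_derivative_inner_left)
  then have fd: "(\<lambda>v. frechet_derivative f (at x) v \<bullet> e) = frechet_derivative (\<lambda>x. f x \<bullet> e) (at x)"
    if "x \<in> U" for x
    using frechet_derivative_at that by blast
  have "Ck_on k U (\<lambda>x. frechet_derivative f (at x) v \<bullet> e)" for v
    using Suc.IH[OF Ck_on_deriv[OF Suc.prems]] .
  then have "Ck_on k U (\<lambda>x. frechet_derivative (\<lambda>x. f x \<bullet> e) (at x) v)" for v
    using Ck_on_cong[OF assms(1)] fd by (metis (no_types, lifting))
  moreover have "(\<lambda>x. f x \<bullet> e) differentiable_on U"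
    using d by (auto simp: differentiable_on_def intro: differentiable_at_withinI differentiableI)
  ultimately show ?case by simp
qed

lemma second_derivative_symmetric:
  fixes f :: "'a::euclidean_space \<Rightarrow> 'b::euclidean_space"
  assumes U: "open U" and f: "Ck_on 2 U f" and x: "x \<in> U"
  shows "frechet_derivative (\<lambda>y. frechet_derivative f (at y) u) (at x) v
       = frechet_derivative (\<lambda>y. frechet_derivative f (at y) v) (at x) u"
proof (rule euclidean_eqI)
  fix e :: 'b
  have f2: "Ck_on (Suc (Suc 0)) U f" using f by (simp add: numeral_2_eq_2)
  let ?g = "\<lambda>y. f y \<bullet> e"
  have gU: "frechet_derivative ?g (at y) = (\<lambda>v. frechet_derivative f (at y) v \<bullet> e)"
    if "y \<in> U" for y
    using frechet_derivative_at[OF has_derivative_inner_left[OF Ck_on_has_derivative[OF f2 U that]]]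
    by simp
  have *: "frechet_derivative (\<lambda>y. frechet_derivative ?g (at y) a) (at x) b
      = frechet_derivative (\<lambda>y. frechet_derivative f (at y) a) (at x) b \<bullet> e" for a b
  proof -
    have "((\<lambda>y. frechet_derivative f (at y) a \<bullet> e) has_derivative
        (\<lambda>b. frechet_derivative (\<lambda>y. frechet_derivative f (at y) a) (at x) b \<bullet> e)) (at x)"
      using Ck_on_has_derivative[OF Ck_on_deriv[OF f2] U x] by (rule has_derivative_inner_left)
    then have "((\<lambda>y. frechet_derivative ?g (at y) a) has_derivative
        (\<lambda>b. frechet_derivative (\<lambda>y. frechet_derivative f (at y) a) (at x) b \<bullet> e)) (at x)"
      by (rule has_derivative_transform_within_open[OF _ U x]) (simp add: gU)
    from frechet_derivative_at[OF this] show ?thesis by metis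
  qed
  show "frechet_derivative (\<lambda>y. frechet_derivative f (at y) u) (at x) v \<bullet> e
      = frechet_derivative (\<lambda>y. frechet_derivative f (at y) v) (at x) u \<bullet> e"
    using second_derivative_symmetric_real[OF U Ck_on_inner[OF U f] x, of e u v] by (simp add: *)
qed

lemma sphere_field_tangent: "sphere_field X \<Longrightarrow> x \<in> sphere 0 1 \<Longrightarrow> X x \<bullet> x = 0"
  by (auto simp: sphere_field_def)

lemma sphere_field_has_derivative:
  assumes "sphere_field X" "x \<in> sphere 0 1"
  shows "(X has_derivative frechet_derivative X (at x)) (at x)"
proof -
  obtain U where U: "open U" "x \<in> U" "Ck_on (Suc 0) U X"
    using assms unfolding sphere_field_def by blast
  show ?thesis by (rule Ck_on_has_derivative[OF U(3,1,2)])
qed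

text \<open>A function vanishing on the sphere has vanishing derivative in tangent directions.\<close>

lemma sphere_tangent_derivative_zero:
  fixes g :: "'a::euclidean_space \<Rightarrow> real"
  assumes g: "\<And>y. y \<in> sphere 0 1 \<Longrightarrow> g y = 0" and d: "(g has_derivative g') (at x)"
    and x: "x \<in> sphere 0 1" and u: "u \<bullet> x = 0"
  shows "g' u = 0"
proof (cases "u = 0")
  case True
  then show ?thesis using d has_derivative_linear linear_0 by blast
next
  case False
  let ?e = "u /\<^sub>R norm u"
  have xx: "x \<bullet> x = 1" using x by (simp add: dot_square_norm)
  have uu: "u \<bullet> u = (norm u)\<^sup>2" by (simp add: dot_square_norm)
  let ?c = "\<lambda>s. cos s *\<^sub>R x + sin s *\<^sub>R ?e"
  have ee: "?e \<bullet> ?e = 1" using False by (simp add: uu field_simps power2_eq_square)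
  have ex: "?e \<bullet> x = 0" "x \<bullet> ?e = 0" using u by (auto simp: inner_commute)
  have circ: "(cos s *\<^sub>R x + sin s *\<^sub>R e) \<bullet> (cos s *\<^sub>R x + sin s *\<^sub>R e) = 1"
    if "e \<bullet> e = 1" "x \<bullet> e = 0" for s e
    using that xx sin_cos_squared_add[of s]
    by (simp add: inner_add_left inner_add_right inner_commute power2_eq_square algebra_simps)
  have "?c s \<bullet> ?c s = 1" for s
    using circ[OF ee ex(2)] .
  then have "norm (?c s) = 1" for s by (simp add: norm_eq_1)
  then have z: "g (?c s) = 0" for s using g by simp
  have c: "(?c has_derivative (\<lambda>h. h *\<^sub>R ?e)) (at 0)"
    by (auto intro!: derivative_eq_intros)
  have d': "(g has_derivative g') (at (?c 0))" using d by simp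
  have "((\<lambda>s. g (?c s)) has_derivative (\<lambda>h. g' (h *\<^sub>R ?e))) (at 0)"
    by (rule has_derivative_compose[OF c d'])
  then have "((\<lambda>s. 0::real) has_derivative (\<lambda>h. g' (h *\<^sub>R ?e))) (at (0::real))"
    by (simp only: z)
  then have "(\<lambda>h. g' (h *\<^sub>R ?e)) = (\<lambda>h. 0)"
    using has_derivative_unique has_derivative_const by blast
  then have "g' (norm u *\<^sub>R ?e) = 0" by metis
  then show ?thesis using False by simp
qed

lemma sphere_field_second_fundamental_form:
  assumes "sphere_field Y" "x \<in> sphere 0 1" "u \<bullet> x = 0"
  shows "frechet_derivative Y (at x) u \<bullet> x = - (Y x \<bullet> u)"
proof -
  have "((\<lambda>y. Y y \<bullet> y) has_derivative (\<lambda>h. Y x \<bullet> h + frechet_derivative Y (at x) h \<bullet> x)) (at x)"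
    by (rule has_derivative_inner[OF sphere_field_has_derivative[OF assms(1,2)] has_derivative_ident])
  from sphere_tangent_derivative_zero[OF _ this assms(2,3)] sphere_field_tangent[OF assms(1)]
  show ?thesis by simp
qed

lemma tan_proj_tangent: "w \<bullet> x = 0 \<Longrightarrow> tan_proj x w = w"
  by (simp add: tan_proj_def)

lemma tan_proj_diff: "tan_proj x (u - v) = tan_proj x u - tan_proj x v"
  by (simp add: tan_proj_def inner_diff_left algebra_simps)

lemma tan_proj_add: "tan_proj x (u + v) = tan_proj x u + tan_proj x v"
  by (simp add: tan_proj_def inner_add_left algebra_simps)

lemma tan_proj_normal: "x \<in> sphere 0 1 \<Longrightarrow> tan_proj x (c *\<^sub>R x) = 0"
  by (simp add: tan_proj_def dot_square_norm)

lemma lie_bracket_tangent: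
  assumes "sphere_field X" "sphere_field Y" "x \<in> sphere 0 1"
  shows "lie_bracket X Y x \<bullet> x = 0"
  using sphere_field_second_fundamental_form[OF assms(2,3) sphere_field_tangent[OF assms(1,3)]]
    sphere_field_second_fundamental_form[OF assms(1,3) sphere_field_tangent[OF assms(2,3)]]
  by (simp add: lie_bracket_def inner_diff_left) (simp add: inner_commute)

lemma sphere_conn_torsion_free:
  assumes "sphere_field X" "sphere_field Y" "x \<in> sphere 0 1"
  shows "sphere_conn X Y x - sphere_conn Y X x = lie_bracket X Y x"
  using tan_proj_tangent[OF lie_bracket_tangent[OF assms]]
  by (simp add: sphere_conn_def lie_bracket_def tan_proj_diff)

lemma sphere_conn_metric:
  assumes "sphere_field X" "sphere_field Y" "sphere_field Z" "x \<in> sphere 0 1"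
  shows "frechet_derivative (\<lambda>y. Y y \<bullet> Z y) (at x) (X x)
       = sphere_conn X Y x \<bullet> Z x + Y x \<bullet> sphere_conn X Z x"
proof -
  have "((\<lambda>y. Y y \<bullet> Z y) has_derivative (\<lambda>h. Y x \<bullet> frechet_derivative Z (at x) h
      + frechet_derivative Y (at x) h \<bullet> Z x)) (at x)"
    by (intro has_derivative_inner sphere_field_has_derivative assms)
  from frechet_derivative_at[OF this, symmetric] show ?thesis
    using sphere_field_tangent[OF assms(2,4)] sphere_field_tangent[OF assms(3,4)]
    by (simp add: sphere_conn_def tan_proj_def inner_diff_left inner_diff_right inner_commute)
qed

lemma cov_deriv_along:
  assumes Y: "sphere_field Y" and \<gamma>: "\<gamma> t \<in> sphere 0 1"
    and d: "\<gamma> differentiable (at t within I)" and nt: "at t within I \<noteq> bot"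
    and X: "X (\<gamma> t) = vderiv I \<gamma> t"
  shows "cov_deriv I \<gamma> (\<lambda>s. Y (\<gamma> s)) t = sphere_conn X Y (\<gamma> t)"
proof -
  have "(\<gamma> has_vector_derivative vderiv I \<gamma> t) (at t within I)"
    using d by (simp add: vderiv_def vector_derivative_works)
  moreover have "(Y has_derivative frechet_derivative Y (at (\<gamma> t))) (at (\<gamma> t) within \<gamma> ` I)"
    using sphere_field_has_derivative[OF Y \<gamma>] has_derivative_at_withinI by blast
  ultimately have *: "(Y \<circ> \<gamma> has_vector_derivative
      frechet_derivative Y (at (\<gamma> t)) (vderiv I \<gamma> t)) (at t within I)"
    by (rule vector_derivative_diff_chain_within)
  have "vderiv I (\<lambda>s. Y (\<gamma> s)) t = frechet_derivative Y (at (\<gamma> t)) (vderiv I \<gamma> t)"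
    unfolding vderiv_def[of I "\<lambda>s. Y (\<gamma> s)"]
    by (rule vector_derivative_within[OF nt *[unfolded o_def]])
  then show ?thesis
    by (simp add: cov_deriv_def sphere_conn_def X)
qed

lemma sphere_conn_conn:
  fixes X Y Z :: "'a::euclidean_space \<Rightarrow> 'a"
  assumes "sphere_field X" "sphere_field Y" "sphere_field Z" and x: "x \<in> sphere 0 1"
  shows "sphere_conn X (sphere_conn Y Z) x =
    tan_proj x (frechet_derivative Z (at x) (frechet_derivative Y (at x) (X x))
      + frechet_derivative (\<lambda>y. frechet_derivative Z (at y) (X x)) (at x) (Y x))
    + (Y x \<bullet> Z x) *\<^sub>R X x"
proof -
  obtain U where U: "open U" "x \<in> U" "Ck_on 2 U Z"
    using assms(3) x unfolding sphere_field_def by blast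
  have Z2: "Ck_on (Suc (Suc 0)) U Z" using U(3) by (simp add: numeral_2_eq_2)
  let ?D = "\<lambda>y. frechet_derivative Z (at y)"
  let ?H = "\<lambda>b. frechet_derivative (\<lambda>y. ?D y b) (at x)"
  let ?A = "\<lambda>a. \<Sum>b\<in>Basis. (Y x \<bullet> b) *\<^sub>R ?H b a + (frechet_derivative Y (at x) a \<bullet> b) *\<^sub>R ?D x b"
  have linD: "linear (?D y)" if "y \<in> U" for y
    using Ck_on_has_derivative[OF Z2 U(1) that] has_derivative_linear by blast
  have H: "((\<lambda>y. ?D y b) has_derivative ?H b) (at x)" for b
    using Ck_on_has_derivative[OF Ck_on_deriv[OF Z2] U(1,2)] .
  have linH: "linear (?H b)" for b using H has_derivative_linear by blast
  have expand: "L w = (\<Sum>b\<in>Basis. (w \<bullet> b) *\<^sub>R L b)" if "linear L" for L :: "'a \<Rightarrow> 'a" and w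
  proof -
    have "L w = L (\<Sum>b\<in>Basis. (w \<bullet> b) *\<^sub>R b)" by (simp only: euclidean_representation)
    also have "\<dots> = (\<Sum>b\<in>Basis. (w \<bullet> b) *\<^sub>R L b)"
      by (simp only: linear_sum[OF that] linear_cmul[OF that])
    finally show ?thesis .
  qed
  have YD: "(Y has_derivative frechet_derivative Y (at x)) (at x)"
    using sphere_field_has_derivative[OF assms(2) x] .
  have "((\<lambda>y. \<Sum>b\<in>Basis. (Y y \<bullet> b) *\<^sub>R ?D y b) has_derivative ?A) (at x)"
    by (intro has_derivative_sum has_derivative_scaleR has_derivative_inner_left YD H)
  then have W: "((\<lambda>y. ?D y (Y y)) has_derivative ?A) (at x)"
    by (rule has_derivative_transform_within_open[OF _ U(1,2)]) (rule expand[OF linD, symmetric])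
  have A: "?A a = ?H a (Y x) + ?D x (frechet_derivative Y (at x) a)" for a
  proof -
    have "?A a = (\<Sum>b\<in>Basis. (Y x \<bullet> b) *\<^sub>R ?H a b) + ?D x (frechet_derivative Y (at x) a)"
      using expand[OF linD[OF U(2)], of "frechet_derivative Y (at x) a"]
        second_derivative_symmetric[OF U(1,3,2), of _ a]
      by (simp add: sum.distrib)
    then show ?thesis using expand[OF linH[of a], of "Y x"] by simp
  qed
  let ?w = "?D x (Y x)"
  have "((\<lambda>y. tan_proj y (?D y (Y y))) has_derivative
     (\<lambda>a. ?A a - ((?w \<bullet> x) *\<^sub>R a + (?w \<bullet> a + ?A a \<bullet> x) *\<^sub>R x))) (at x)"
    unfolding tan_proj_def
    by (intro has_derivative_diff has_derivative_scaleR has_derivative_inner W has_derivative_ident)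
  then have fd: "frechet_derivative (sphere_conn Y Z) (at x) =
     (\<lambda>a. ?A a - ((?w \<bullet> x) *\<^sub>R a + (?w \<bullet> a + ?A a \<bullet> x) *\<^sub>R x))"
    unfolding sphere_conn_def by (rule frechet_derivative_at[symmetric])
  have w: "?w \<bullet> x = - (Y x \<bullet> Z x)"
    using sphere_field_second_fundamental_form[OF assms(3) x sphere_field_tangent[OF assms(2) x]]
    by (simp add: inner_commute)
  have "sphere_conn X (sphere_conn Y Z) x
    = tan_proj x (?A (X x)) - tan_proj x ((?w \<bullet> x) *\<^sub>R X x)"
    unfolding sphere_conn_def[of X] fd
    using tan_proj_normal[OF x] by (simp add: tan_proj_diff tan_proj_add)
  moreover have "tan_proj x ((?w \<bullet> x) *\<^sub>R X x) = - (Y x \<bullet> Z x) *\<^sub>R X x"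
    using sphere_field_tangent[OF assms(1) x] by (subst tan_proj_tangent) (auto simp: w)
  ultimately show ?thesis
    by (simp only: A) (simp add: add.commute)
qed

lemma field_curvature_eq:
  assumes "sphere_field X" "sphere_field Y" "sphere_field Z" and x: "x \<in> sphere 0 1"
  shows "field_curvature X Y Z x = (Y x \<bullet> Z x) *\<^sub>R X x - (X x \<bullet> Z x) *\<^sub>R Y x"
proof -
  obtain U where U: "open U" "x \<in> U" "Ck_on 2 U Z"
    using assms(3) x unfolding sphere_field_def by blast
  have lin: "linear (frechet_derivative Z (at x))"
    using sphere_field_has_derivative[OF assms(3) x] has_derivative_linear by blast
  show ?thesis
    unfolding field_curvature_def sphere_conn_conn[OF assms(1-3) x] sphere_conn_conn[OF assms(2,1,3) x]
    using second_derivative_symmetric[OF U(1,3,2), of "X x" "Y x"]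
    by (simp add: sphere_conn_def lie_bracket_def linear_diff[OF lin] tan_proj_add tan_proj_diff)
qed

lemma sphere_curvature_eq:
  assumes "sphere_field X" "sphere_field Y" "sphere_field Z" "x \<in> sphere 0 1"
  shows "sphere_curvature x (X x) (Y x) (Z x) = field_curvature X Y Z x"
  unfolding sphere_curvature_def
proof (rule the_equality)
  show "\<forall>X' Y' Z'. sphere_field X' \<and> sphere_field Y' \<and> sphere_field Z' \<and>
      X' x = X x \<and> Y' x = Y x \<and> Z' x = Z x \<longrightarrow>
      field_curvature X' Y' Z' x = field_curvature X Y Z x"
    using field_curvature_eq assms by metis
next
  fix r
  assume r: "\<forall>X' Y' Z'. sphere_field X' \<and> sphere_field Y' \<and> sphere_field Z' \<and>
      X' x = X x \<and> Y' x = Y x \<and> Z' x = Z x \<longrightarrow> field_curvature X' Y' Z' x = r"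
  show "r = field_curvature X Y Z x"
    using r[rule_format, of X Y Z] assms by simp
qed

lemma sphere_curvature_constant_curvature:
  assumes "x \<in> sphere 0 1" "u \<bullet> x = 0" "v \<bullet> x = 0" "w \<bullet> x = 0"
  shows "sphere_curvature x u v w = (v \<bullet> w) *\<^sub>R u - (u \<bullet> w) *\<^sub>R v"
proof -
  obtain X Y Z where "sphere_field X" "X x = u" "sphere_field Y" "Y x = v" "sphere_field Z" "Z x = w"
    using sphere_field_extension assms by metis
  then show ?thesis
    using sphere_curvature_eq field_curvature_eq assms(1) by metis
qed

end

theory Submission
  imports Defs
begin

text \<open>
  Such a curve is a sum \<open>\<gamma> = u + v\<close> of two mutually orthogonal circular motions, of squared radius
  \<open>1/2\<close>, with \<open>u'' = - a\<^sup>2 u\<close>, \<open>v'' = - b\<^sup>2 v\<close> and \<open>a\<^sup>2 + b\<^sup>2 = 2\<close> (in the first family \<open>v\<close> is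
  constant and \<open>b = 0\<close>). Projecting \<open>\<gamma>''\<close> gives \<open>\<tau> = (1 - a\<^sup>2) (u - v)\<close>. The field \<open>u - v\<close> is
  orthogonal to \<open>\<gamma>\<close> and \<open>\<gamma>'\<close>, and its second covariant derivative is \<open>-(u - v)\<close>; so the rough
  Laplacian fixes \<open>\<tau>\<close>, and since \<open>R(\<tau>, \<gamma>')\<gamma>' = \<tau>\<close> the two terms of \<open>\<tau>\<^sub>k\<close> cancel for every \<open>k\<close>.
\<close>

text \<open>A derivative within \<open>I\<close> sees only values on \<open>I\<close>, and it is
  unique because \<open>t\<close> is not isolated in \<open>I\<close>. Agreement on \<open>I\<close>
  is the right hypothesis, since the closed forms of iterated \<open>vderiv I\<close> are
  established only there.\<close>

lemma vderiv_eqI: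
  assumes "at t within I \<noteq> bot" "t \<in> I" "\<And>s. s \<in> I \<Longrightarrow> f s = g s"
    and "(g has_vector_derivative d) (at t within I)"
  shows "vderiv I f t = d"
proof -
  have "(f has_vector_derivative d) (at t within I)"
    using has_vector_derivative_transform[OF assms(2) _ assms(4)] assms(3) by blast
  then show ?thesis
    unfolding vderiv_def by (rule vector_derivative_within[OF assms(1)])
qed

text \<open>A connected set with a second point has no isolated points; the nonempty interior
  excludes the degenerate interval \<open>{t}\<close>.\<close>

lemma interval_at_within_neq_bot:
  fixes I :: "real set"
  assumes "is_interval I" "interior I \<noteq> {}" "t \<in> I"
  shows "at t within I \<noteq> bot"
proof -
  have "I \<noteq> {t}"
    using assms(2) by auto
  then have "t islimpt I"
    using assms by (intro connected_imp_perfect is_interval_connected) auto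
  then show ?thesis
    by (simp add: trivial_limit_within)
qed

lemma tan_proj_scaleR: "tan_proj x (c *\<^sub>R w) = c *\<^sub>R tan_proj x w"
  by (simp add: tan_proj_def scaleR_diff_right)

text \<open>Common frame for both families: \<open>A\<close> and \<open>B\<close> are the squared
  angular speeds, and \<open>u\<close>, \<open>v\<close>, \<open>u'\<close>, \<open>v'\<close> have
  a diagonal Gram matrix. Velocities are parameters, so a constant \<open>v\<close> with
  \<open>v'\<close> and \<open>B\<close> zero is an instance.\<close>

locale orthogonal_motions =
  fixes I :: "real set" and u u' v v' :: "real \<Rightarrow> 'a::euclidean_space" and A B :: real
  assumes nontrivial: "\<And>t. t \<in> I \<Longrightarrow> at t within I \<noteq> bot"
    and derivs: "\<And>t. (u has_vector_derivative u' t) (at t within I)"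
      "\<And>t. (v has_vector_derivative v' t) (at t within I)"
      "\<And>t. (u' has_vector_derivative - (A *\<^sub>R u t)) (at t within I)"
      "\<And>t. (v' has_vector_derivative - (B *\<^sub>R v t)) (at t within I)"
    and inner: "\<And>t. u t \<bullet> u t = 1 / 2" "\<And>t. v t \<bullet> v t = 1 / 2"
      "\<And>t. u' t \<bullet> u' t = A / 2" "\<And>t. v' t \<bullet> v' t = B / 2"
      "\<And>t. u t \<bullet> v t = 0" "\<And>t. u t \<bullet> u' t = 0" "\<And>t. u t \<bullet> v' t = 0"
      "\<And>t. v t \<bullet> u' t = 0" "\<And>t. v t \<bullet> v' t = 0" "\<And>t. u' t \<bullet> v' t = 0"
    and AB: "A + B = 2"
begin

definition \<gamma> :: "real \<Rightarrow> 'a" where "\<gamma> t = u t + v t"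

definition N :: "real \<Rightarrow> 'a" where "N t = u t - v t"

text \<open>Expanding inner products of sums yields mixed terms in either order, so each mixed fact
  is kept in both orientations.\<close>

lemmas inner_all = inner inner[unfolded inner_commute[of "u _" "v _"] inner_commute[of "u _" "u' _"]
  inner_commute[of "u _" "v' _"] inner_commute[of "v _" "u' _"] inner_commute[of "v _" "v' _"]
  inner_commute[of "u' _" "v' _"]]

text \<open>By the two second-order equations, combinations of \<open>u\<close>, \<open>v\<close>,
  \<open>u'\<close>, \<open>v'\<close> with constant coefficients are closed under differentiation.
  Every field differentiated in this locale agrees on \<open>I\<close> with such a combination, so
  derivatives reduce to tracking four coefficients.\<close>

lemma combination_has_vector_derivative:
  "((\<lambda>t. p *\<^sub>R u t + q *\<^sub>R v t + r *\<^sub>R u' t + s *\<^sub>R v' t) has_vector_derivative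
     (- A * r) *\<^sub>R u t + (- B * s) *\<^sub>R v t + p *\<^sub>R u' t + q *\<^sub>R v' t) (at t within I)"
  by (auto intro!: derivative_eq_intros derivs simp: mult.commute)

lemma vderiv_combination:
  assumes "t \<in> I" "\<And>t. t \<in> I \<Longrightarrow> f t = p *\<^sub>R u t + q *\<^sub>R v t + r *\<^sub>R u' t + s *\<^sub>R v' t"
  shows "vderiv I f t = (- A * r) *\<^sub>R u t + (- B * s) *\<^sub>R v t + p *\<^sub>R u' t + q *\<^sub>R v' t"
  by (rule vderiv_eqI[OF nontrivial[OF assms(1)] assms combination_has_vector_derivative])

text \<open>Supplies the smoothness of the curve: each iterated derivative stays in the span and
  hence is differentiable again.\<close>

lemma iterated_vderiv_\<gamma>:
  "\<exists>p q r s. \<forall>t\<in>I. (vderiv I ^^ k) \<gamma> t = p *\<^sub>R u t + q *\<^sub>R v t + r *\<^sub>R u' t + s *\<^sub>R v' t"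
proof (induction k)
  case 0
  show ?case
    by (rule exI[of _ 1], rule exI[of _ 1], rule exI[of _ 0], rule exI[of _ 0]) (simp add: \<gamma>_def)
next
  case (Suc k)
  then obtain p q r s where
    "\<And>t. t \<in> I \<Longrightarrow> (vderiv I ^^ k) \<gamma> t = p *\<^sub>R u t + q *\<^sub>R v t + r *\<^sub>R u' t + s *\<^sub>R v' t"
    by blast
  from vderiv_combination[OF _ this] show ?case
    unfolding funpow.simps o_def by blast
qed

lemma iterated_vderiv_\<gamma>_differentiable:
  assumes "t \<in> I"
  shows "(vderiv I ^^ k) \<gamma> differentiable (at t within I)"
proof -
  obtain p q r s where
    eq: "\<And>t. t \<in> I \<Longrightarrow> (vderiv I ^^ k) \<gamma> t = p *\<^sub>R u t + q *\<^sub>R v t + r *\<^sub>R u' t + s *\<^sub>R v' t"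
    using iterated_vderiv_\<gamma> by blast
  show ?thesis
    using has_vector_derivative_transform[OF assms eq combination_has_vector_derivative]
    by (blast intro: differentiableI_vector)
qed

lemma vderiv_\<gamma>: "t \<in> I \<Longrightarrow> vderiv I \<gamma> t = u' t + v' t"
  using vderiv_combination[of t \<gamma> 1 1 0 0] by (simp add: \<gamma>_def)

lemma \<gamma>_in_sphere: "\<gamma> t \<in> sphere 0 1"
  by (simp add: \<gamma>_def norm_eq_1 inner_add_left inner_add_right inner_all)

lemma unit_speed: "unit_speed_sphere_curve I \<gamma>"
proof -
  \<comment> \<open>The squared speed is \<open>A / 2 + B / 2\<close>, which equals 1 by
    \<open>AB\<close>.\<close>
  have "norm (vderiv I \<gamma> t) = 1" if "t \<in> I" for t
    using AB by (simp add: vderiv_\<gamma>[OF that] norm_eq_1 inner_add_left inner_add_right inner_all)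
  then show ?thesis
    using \<gamma>_in_sphere iterated_vderiv_\<gamma>_differentiable
    by (simp add: unit_speed_sphere_curve_def)
qed

text \<open>The acceleration has normal component \<open>- (A + B) / 2 = - 1\<close>, so projecting
  adds \<open>\<gamma> t\<close>; then \<open>1 - B = A - 1\<close> leaves a multiple of
  \<open>N t\<close>.\<close>

lemma tension_\<gamma>:
  assumes "t \<in> I"
  shows "tension I \<gamma> t = (1 - A) *\<^sub>R N t"
proof -
  have acc: "vderiv I (vderiv I \<gamma>) t = - (A *\<^sub>R u t) - B *\<^sub>R v t"
    using vderiv_combination[OF assms, of "vderiv I \<gamma>" 0 0 1 1] by (simp add: vderiv_\<gamma>)
  have B: "B = 2 - A" using AB by simp
  have inn: "(- (A *\<^sub>R u t) - B *\<^sub>R v t) \<bullet> \<gamma> t = - 1"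
    by (simp add: \<gamma>_def inner_add_right inner_diff_left inner_all B
        add_divide_distrib diff_divide_distrib)
  show ?thesis
    unfolding tension_def cov_deriv_def acc tan_proj_def inn
    by (simp add: \<gamma>_def N_def B algebra_simps scaleR_2)
qed

text \<open>Constant multiples of \<open>N\<close> are eigenfields with eigenvalue 1. Prescribing
  \<open>V\<close> on \<open>I\<close> only is what lets the result be iterated.\<close>

lemma rough_laplacian_N:
  assumes "t \<in> I" and V: "\<And>t. t \<in> I \<Longrightarrow> V t = c *\<^sub>R N t"
  shows "rough_laplacian I \<gamma> V t = c *\<^sub>R N t"
proof -
  have "vderiv I V s = c *\<^sub>R u' s - c *\<^sub>R v' s" if "s \<in> I" for s
    using vderiv_combination[OF that, of V c "- c" 0 0] V by (simp add: N_def algebra_simps)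
  \<comment> \<open>The first derivative is already orthogonal to \<open>\<gamma> s\<close>, so this
    projection changes nothing.\<close>
  then have DV: "cov_deriv I \<gamma> V s = c *\<^sub>R u' s - c *\<^sub>R v' s" if "s \<in> I" for s
    using that by (simp add: cov_deriv_def tan_proj_def \<gamma>_def inner_add_right inner_diff_left inner_all)
  have DDV: "vderiv I (cov_deriv I \<gamma> V) t = c *\<^sub>R (B *\<^sub>R v t - A *\<^sub>R u t)"
    using vderiv_combination[OF assms(1), of "cov_deriv I \<gamma> V" 0 0 c "- c"]
    by (simp add: DV algebra_simps)
  have B: "B = 2 - A" using AB by simp
  have inn: "(B *\<^sub>R v t - A *\<^sub>R u t) \<bullet> \<gamma> t = 1 - A"
    by (simp add: \<gamma>_def inner_add_right inner_diff_left inner_all B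
        add_divide_distrib diff_divide_distrib)
  have "tan_proj (\<gamma> t) (B *\<^sub>R v t - A *\<^sub>R u t) = - N t"
    unfolding tan_proj_def inn by (simp add: \<gamma>_def N_def B algebra_simps scaleR_2)
  then show ?thesis
    unfolding rough_laplacian_def cov_deriv_def[of I \<gamma> "cov_deriv I \<gamma> V"] DDV
    by (simp add: tan_proj_scaleR)
qed

lemma iterated_rough_laplacian_tension:
  "t \<in> I \<Longrightarrow> (rough_laplacian I \<gamma> ^^ j) (tension I \<gamma>) t = (1 - A) *\<^sub>R N t"
  by (induction j arbitrary: t) (simp_all add: tension_\<gamma> rough_laplacian_N)

text \<open>In the constant curvature formula the velocity is a unit vector orthogonal to
  \<open>N t\<close>, so only the first term survives. Orthogonality to \<open>\<gamma> t\<close> is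
  checked because the formula is for tangent vectors.\<close>

lemma sphere_curvature_N:
  assumes "t \<in> I"
  shows "sphere_curvature (\<gamma> t) (c *\<^sub>R N t) (vderiv I \<gamma> t) (vderiv I \<gamma> t) = c *\<^sub>R N t"
proof -
  have "(u' t + v' t) \<bullet> (u' t + v' t) = 1" "N t \<bullet> (u' t + v' t) = 0" "N t \<bullet> \<gamma> t = 0"
    "(u' t + v' t) \<bullet> \<gamma> t = 0"
    using AB by (simp_all add: N_def \<gamma>_def inner_add_left inner_add_right inner_diff_left inner_all)
  then show ?thesis
    by (simp add: vderiv_\<gamma>[OF assms] sphere_curvature_constant_curvature[OF \<gamma>_in_sphere])
qed

text \<open>Both iterates of the rough Laplacian equal \<open>(1 - A) *\<^sub>R N t\<close>, and the
  curvature term returns its argument, so the difference vanishes.\<close>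

lemma k_harmonic_\<gamma>: "2 \<le> k \<Longrightarrow> k_harmonic k I \<gamma>"
  by (simp add: k_harmonic_def unit_speed k_tension_def iterated_rough_laplacian_tension
      sphere_curvature_N)

end

text \<open>Taking the pair \<open>c\<close>, \<open>d\<close> as arguments keeps velocities in the
  same form: differentiation replaces it by \<open>d\<close>, \<open>- c\<close> and multiplies by
  \<open>a\<close>.\<close>

definition rotation :: "real \<Rightarrow> 'a::euclidean_space \<Rightarrow> 'a \<Rightarrow> real \<Rightarrow> 'a" where
  "rotation a c d t = cos (a * t) *\<^sub>R c + sin (a * t) *\<^sub>R d"

lemma rotation_has_vector_derivative:
  "(rotation a c d has_vector_derivative a *\<^sub>R rotation a d (- c) t) (at t within I)"
  unfolding rotation_def[abs_def]
  by (auto intro!: derivative_eq_intros simp: algebra_simps)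

lemma velocity_has_vector_derivative:
  "((\<lambda>t. a *\<^sub>R rotation a d (- c) t) has_vector_derivative - (a\<^sup>2 *\<^sub>R rotation a c d t)) (at t within I)"
  unfolding rotation_def
  by (auto intro!: derivative_eq_intros simp: algebra_simps power2_eq_square)

lemma rotation_inner_self:
  assumes "c \<bullet> c = r" "d \<bullet> d = r" "c \<bullet> d = 0"
  shows "rotation a c d t \<bullet> rotation a c d t = r"
proof -
  have "rotation a c d t \<bullet> rotation a c d t = r * (cos (a * t))\<^sup>2 + r * (sin (a * t))\<^sup>2"
    using assms by (simp add: rotation_def inner_add_left inner_add_right inner_commute[of d c]
        algebra_simps power2_eq_square)
  then show ?thesis by (simp flip: distrib_left)
qed

text \<open>The only surviving terms are \<open>cos (a * t) * sin (a * t)\<close> times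
  \<open>d \<bullet> d - c \<bullet> c\<close>, which cancel for equal radii.\<close>

lemma rotation_inner_velocity:
  assumes "c \<bullet> c = d \<bullet> d" "c \<bullet> d = 0"
  shows "rotation a c d t \<bullet> rotation a d (- c) t = 0"
  using assms by (simp add: rotation_def inner_add_left inner_add_right inner_diff_right inner_commute[of d c])

lemma rotation_inner_orthogonal:
  assumes "c \<bullet> e = 0" "d \<bullet> e = 0"
  shows "rotation a c d t \<bullet> e = 0"
  using assms by (simp add: rotation_def inner_add_left)

lemma rotation_rotation_orthogonal:
  assumes "c \<bullet> e = 0" "c \<bullet> f = 0" "d \<bullet> e = 0" "d \<bullet> f = 0"
  shows "rotation a c d t \<bullet> rotation b e f t = 0"
  using assms by (simp add: rotation_def inner_add_left inner_add_right)

lemma k_harmonic_rotation_plus_const: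
  assumes I: "is_interval I" "interior I \<noteq> {}" and k: "2 \<le> k"
    and orth: "orthogonal c1 c2" "orthogonal c1 c4" "orthogonal c2 c4"
    and norms: "(norm c1)\<^sup>2 = 1 / 2" "(norm c2)\<^sup>2 = 1 / 2" "(norm c4)\<^sup>2 = 1 / 2"
  shows "k_harmonic k I (\<lambda>t. cos (sqrt 2 * t) *\<^sub>R c1 + sin (sqrt 2 * t) *\<^sub>R c2 + c4)"
proof -
  have ip: "c1 \<bullet> c2 = 0" "c2 \<bullet> c1 = 0" "c1 \<bullet> c4 = 0" "c2 \<bullet> c4 = 0" "c4 \<bullet> c1 = 0" "c4 \<bullet> c2 = 0"
    "c1 \<bullet> c1 = 1 / 2" "c2 \<bullet> c2 = 1 / 2" "c4 \<bullet> c4 = 1 / 2"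
    using orth norms by (auto simp: orthogonal_def inner_commute power2_norm_eq_inner)
  \<comment> \<open>Here \<open>A\<close> is 2 and \<open>B\<close> is 0: the second motion rests at
    \<open>c4\<close>.\<close>
  interpret orthogonal_motions I "rotation (sqrt 2) c1 c2"
    "\<lambda>t. sqrt 2 *\<^sub>R rotation (sqrt 2) c2 (- c1) t" "\<lambda>t. c4" "\<lambda>t. 0" "(sqrt 2)\<^sup>2" 0
    by unfold_locales
      (auto simp: ip interval_at_within_neq_bot[OF I] rotation_inner_self[where r = "1/2"]
        rotation_inner_velocity rotation_inner_orthogonal inner_commute[of c4 "rotation _ _ _ _"]
        intro: rotation_has_vector_derivative velocity_has_vector_derivative[of "sqrt 2", simplified])
  show ?thesis
    using k_harmonic_\<gamma>[OF k] by (simp add: \<gamma>_def[abs_def] rotation_def)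
qed

lemma k_harmonic_rotation_plus_rotation:
  assumes I: "is_interval I" "interior I \<noteq> {}" and k: "2 \<le> k"
    and orth: "orthogonal c1 c2" "orthogonal c1 c3" "orthogonal c1 c4"
      "orthogonal c2 c3" "orthogonal c2 c4" "orthogonal c3 c4"
    and norms: "(norm c1)\<^sup>2 = 1 / 2" "(norm c2)\<^sup>2 = 1 / 2" "(norm c3)\<^sup>2 = 1 / 2" "(norm c4)\<^sup>2 = 1 / 2"
    and ab: "a\<^sup>2 + b\<^sup>2 = 2"
  shows "k_harmonic k I
    (\<lambda>t. cos (a * t) *\<^sub>R c1 + sin (a * t) *\<^sub>R c2 + cos (b * t) *\<^sub>R c3 + sin (b * t) *\<^sub>R c4)"
proof -
  have ip: "c1 \<bullet> c2 = 0" "c2 \<bullet> c1 = 0" "c1 \<bullet> c3 = 0" "c3 \<bullet> c1 = 0" "c1 \<bullet> c4 = 0" "c4 \<bullet> c1 = 0"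
    "c2 \<bullet> c3 = 0" "c3 \<bullet> c2 = 0" "c2 \<bullet> c4 = 0" "c4 \<bullet> c2 = 0" "c3 \<bullet> c4 = 0" "c4 \<bullet> c3 = 0"
    "c1 \<bullet> c1 = 1 / 2" "c2 \<bullet> c2 = 1 / 2" "c3 \<bullet> c3 = 1 / 2" "c4 \<bullet> c4 = 1 / 2"
    using orth norms by (auto simp: orthogonal_def inner_commute power2_norm_eq_inner)
  \<comment> \<open>Squares are rewritten as products in the goals, so \<open>ab\<close> and the
    derivative rule are supplied in that form too.\<close>
  interpret orthogonal_motions I "rotation a c1 c2" "\<lambda>t. a *\<^sub>R rotation a c2 (- c1) t"
    "rotation b c3 c4" "\<lambda>t. b *\<^sub>R rotation b c4 (- c3) t" "a\<^sup>2" "b\<^sup>2"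
    by unfold_locales
      (auto simp: ip ab[unfolded power2_eq_square] interval_at_within_neq_bot[OF I] rotation_inner_self[where r = "1/2"]
        rotation_inner_velocity rotation_rotation_orthogonal power2_eq_square
        intro: rotation_has_vector_derivative velocity_has_vector_derivative[unfolded power2_eq_square])
  show ?thesis
    using k_harmonic_\<gamma>[OF k] by (simp add: \<gamma>_def[abs_def] rotation_def add.assoc)
qed

theorem proposition7p8:
  fixes n :: nat and I :: "real set"
  assumes "CARD('m::finite) = n + 1" and "is_interval I" and "interior I \<noteq> {}"
  shows
    "(\<forall>c1 c2 c4 :: real ^ 'm.
        orthogonal c1 c2 \<and> orthogonal c1 c4 \<and> orthogonal c2 c4 \<and>
        (norm c1)\<^sup>2 = 1 / 2 \<and> (norm c2)\<^sup>2 = 1 / 2 \<and> (norm c4)\<^sup>2 = 1 / 2 \<longrightarrow>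
        (let \<gamma> = (\<lambda>t. cos (sqrt 2 * t) *\<^sub>R c1 + sin (sqrt 2 * t) *\<^sub>R c2 + c4)
         in k_harmonic 3 I \<gamma> \<and> k_harmonic 4 I \<gamma>)) \<and>
     (\<forall>(c1 :: real ^ 'm) c2 c3 c4 (a :: real) b.
        orthogonal c1 c2 \<and> orthogonal c1 c3 \<and> orthogonal c1 c4 \<and>
        orthogonal c2 c3 \<and> orthogonal c2 c4 \<and> orthogonal c3 c4 \<and>
        (norm c1)\<^sup>2 = 1 / 2 \<and> (norm c2)\<^sup>2 = 1 / 2 \<and> (norm c3)\<^sup>2 = 1 / 2 \<and> (norm c4)\<^sup>2 = 1 / 2 \<and>
        a\<^sup>2 + b\<^sup>2 = 2 \<and> a\<^sup>2 \<noteq> b\<^sup>2 \<longrightarrow>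
        (let \<gamma> = (\<lambda>t. cos (a * t) *\<^sub>R c1 + sin (a * t) *\<^sub>R c2 + cos (b * t) *\<^sub>R c3 + sin (b * t) *\<^sub>R c4)
         in k_harmonic 3 I \<gamma> \<and> k_harmonic 4 I \<gamma>))"
\<comment> \<open>Orders 3 and 4 are instances of the two results for general
  \<open>k\<close>.\<close>
proof (intro conjI allI impI)
  fix c1 c2 c4 :: "real ^ 'm"
  assume "orthogonal c1 c2 \<and> orthogonal c1 c4 \<and> orthogonal c2 c4 \<and>
    (norm c1)\<^sup>2 = 1 / 2 \<and> (norm c2)\<^sup>2 = 1 / 2 \<and> (norm c4)\<^sup>2 = 1 / 2"
  then show "let \<gamma> = (\<lambda>t. cos (sqrt 2 * t) *\<^sub>R c1 + sin (sqrt 2 * t) *\<^sub>R c2 + c4)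
    in k_harmonic 3 I \<gamma> \<and> k_harmonic 4 I \<gamma>"
    unfolding Let_def by (intro conjI k_harmonic_rotation_plus_const assms) auto
next
  fix c1 c2 c3 c4 :: "real ^ 'm" and a b :: real
  assume "orthogonal c1 c2 \<and> orthogonal c1 c3 \<and> orthogonal c1 c4 \<and>
    orthogonal c2 c3 \<and> orthogonal c2 c4 \<and> orthogonal c3 c4 \<and>
    (norm c1)\<^sup>2 = 1 / 2 \<and> (norm c2)\<^sup>2 = 1 / 2 \<and> (norm c3)\<^sup>2 = 1 / 2 \<and> (norm c4)\<^sup>2 = 1 / 2 \<and>
    a\<^sup>2 + b\<^sup>2 = 2 \<and> a\<^sup>2 \<noteq> b\<^sup>2"
  then show "let \<gamma> = (\<lambda>t. cos (a * t) *\<^sub>R c1 + sin (a * t) *\<^sub>R c2 + cos (b * t) *\<^sub>R c3 + sin (b * t) *\<^sub>R c4)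
    in k_harmonic 3 I \<gamma> \<and> k_harmonic 4 I \<gamma>"
    unfolding Let_def by (intro conjI k_harmonic_rotation_plus_rotation assms) auto
qed

end
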